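(* Let $D_1 \subset \mathbb{C}^N$ be a domain, let $R$ be a positive real number or $+\infty$, let $D_2 := \{ w \in \mathbb{C} \mid |w| < R \}$, and let $D := D_1 \times D_2$. Let $$F(\boldsymbol{z}, w) := \sum_{n=0}^{\infty} f_n(\boldsymbol{z}) w^n \in \mathcal{O}(D_1)[[w]], \qquad f_n \in \mathcal{O}(D_1),$$ be a formal power series. Assume the following two conditions. (C1) There exists a dense subset $S$ of $D_1$ such that for all $\boldsymbol{\alpha} \in S$ the power series $F|_{\boldsymbol{z} = \boldsymbol{\alpha}} = \sum_{n=0}^\infty f_n(\boldsymbol{\alpha}) w^n$ converges on $D_2$ and $F|_{\boldsymbol{z} = \boldsymbol{\alpha}} \in \mathcal{O}(D_2)$. (C2) $F$ is algebraic over $\mathcal{O}(D)$, i.e. there exists a polynomial $$\Phi(\boldsymbol{z}, w, X) := \sum_{j=0}^{t} \Phi_j(\boldsymbol{z}, w) X^{t-j} \in \mathcal{O}(D)[X] \qquad (t \geq 1,\ \Phi_0 \not\equiv 0)$$ such that $\Phi(\boldsymbol{z}, w, F(\boldsymbol{z}, w)) \equiv 0$ holds as an equality in $\mathcal{O}(D_1)[[w]]$. Then $F$ converges in $D$ and $F \in \mathcal{O}(D)$.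
   Context: For a complex domain $U$, $\mathcal{O}(U)$ denotes the ring of holomorphic functions on $U$. When $R = +\infty$, $D_2 = \mathbb{C}$. The ring $\mathcal{O}(D)$ is regarded as a subring of $\mathcal{O}(D_1)[[w]]$ by the power series expansion with respect to $w$ (at $w=0$); thus "$F \in \mathcal{O}(D)$" means that the series $F$ converges on $D$ to a holomorphic function, whose expansion in $w$ it is. *)

theory Defs
  imports
    "HOL-Complex_Analysis.Complex_Analysis"
    "HOL-Library.Function_Algebras"
begin

(* The libraries have no type class of complex normed spaces, so the complex scalar
   multiplication smul of the source space is a parameter: holomorphic means that the real
   (Frechet) derivative exists at every point of the open set U and is complex linear. *)
definition holomorphic_wrt ::
    "(complex \<Rightarrow> 'a \<Rightarrow> 'a) \<Rightarrow> ('a::real_normed_vector \<Rightarrow> complex) \<Rightarrow> 'a set \<Rightarrow> bool" where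
  "holomorphic_wrt smul f U \<longleftrightarrow>
     (\<forall>p\<in>U. \<exists>f'. (f has_derivative f') (at p) \<and> (\<forall>c v. f' (smul c v) = c * f' v))"

definition smul_prod ::
    "complex \<Rightarrow> (complex^'N) \<times> complex \<Rightarrow> (complex^'N) \<times> complex" where
  "smul_prod c p = (c *s fst p, c * snd p)"

definition holo_N :: "(complex^'N \<Rightarrow> complex) \<Rightarrow> (complex^'N) set \<Rightarrow> bool" where
  "holo_N = holomorphic_wrt (*s)"

definition holo_N1 ::
    "((complex^'N) \<times> complex \<Rightarrow> complex) \<Rightarrow> ((complex^'N) \<times> complex) set \<Rightarrow> bool" where
  "holo_N1 = holomorphic_wrt smul_prod"

(* Functions on a domain are represented by total functions whose values outside the domain are
   irrelevant. An element of O(U)[[w]] is thus a formal power series over the pointwise ring of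
   functions with coefficients holomorphic on U, and equality in O(U)[[w]] is fps_eq_on U. *)
definition fps_eq_on :: "'a set \<Rightarrow> ('a \<Rightarrow> complex) fps \<Rightarrow> ('a \<Rightarrow> complex) fps \<Rightarrow> bool" where
  "fps_eq_on U F G \<longleftrightarrow> (\<forall>n. \<forall>z\<in>U. fps_nth F n z = fps_nth G n z)"

definition fps_at :: "('a \<Rightarrow> complex) fps \<Rightarrow> 'a \<Rightarrow> complex fps" where
  "fps_at F z = Abs_fps (\<lambda>n. fps_nth F n z)"

(* Power series expansion in the last variable at w = 0: the embedding of O(D1 x D2) into
   O(D1)[[w]]. *)
definition w_expansion :: "('a \<times> complex \<Rightarrow> complex) \<Rightarrow> ('a \<Rightarrow> complex) fps" where
  "w_expansion g = Abs_fps (\<lambda>n z. fps_nth (fps_expansion (\<lambda>w. g (z, w)) 0) n)"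

end

theory Submission
  imports Defs
begin

text \<open>
  At a point \<open>\<alpha> \<in> S\<close> the algebraic equation holds pointwise on the whole disc, so on a circle where
  \<open>\<Phi> 0 (z0, _)\<close> has no zero the roots, and hence the values of the series at \<open>\<alpha>\<close> near \<open>z0\<close>, are
  bounded uniformly in \<open>\<alpha>\<close>. Cauchy's estimate bounds the coefficients \<open>f_n(\<alpha>)\<close> geometrically, and by
  density of \<open>S\<close> the bound holds at all points near \<open>z0\<close>. If \<open>\<Phi> 0 (z0, _)\<close> vanishes identically,
  the identity theorem gives a small circle around \<open>z0\<close> in a complex line which avoids all such bad
  points, and the maximum principle for the \<open>f_n\<close> on parallel discs carries the bound to a
  neighbourhood of \<open>z0\<close>. Thus the series converges normally on the domain.
\<close>

section \<open>Holomorphic functions on complex normed spaces\<close>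

lemma norm_vector_smult: "norm (c *s (v :: complex^'N)) = norm c * norm v"
  by (simp add: norm_vec_def norm_mult L2_set_right_distrib)

lemma norm_smul_prod: "norm (smul_prod c p) = norm c * norm p"
  by (simp add: smul_prod_def norm_prod_def norm_vector_smult norm_mult power_mult_distrib
      flip: distrib_left) (simp add: real_sqrt_mult)

text \<open>Captures what \<open>complex^'N\<close> and \<open>(complex^'N) \<times> complex\<close>
  have in common, so that restriction to complex lines, the identity theorem and termwise
  differentiation are proved once for both.\<close>

locale complex_scaling =
  fixes smul :: "complex \<Rightarrow> 'a::real_normed_vector \<Rightarrow> 'a"
  assumes smul_add: "smul (c + d) v = smul c v + smul d v"
    and smul_of_real: "smul (of_real r) v = r *\<^sub>R v"
    and smul_scaleR: "smul (r *\<^sub>R c) v = r *\<^sub>R smul c v"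
    and norm_smul: "norm (smul c v) = norm c * norm v"
begin

lemma smul_one [simp]: "smul 1 v = v"
  using smul_of_real[of 1 v] by simp

lemma smul_zero [simp]: "smul 0 v = 0"
  using smul_of_real[of 0 v] by simp

lemma bounded_linear_smul: "bounded_linear (\<lambda>c. smul c v)"
  by (rule bounded_linear_intro[of _ "norm v"])
    (simp_all add: smul_add smul_scaleR norm_smul)

lemma has_field_derivative_on_line:
  assumes "(f has_derivative f') (at (a + smul \<zeta> v))" "\<And>c v. f' (smul c v) = c * f' v"
  shows "((\<lambda>\<zeta>. f (a + smul \<zeta> v)) has_field_derivative f' v) (at \<zeta>)"
proof -
  have "((\<lambda>\<zeta>. a + smul \<zeta> v) has_derivative (\<lambda>c. smul c v)) (at \<zeta>)"
    using has_derivative_add[OF has_derivative_const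
        bounded_linear_imp_has_derivative[OF bounded_linear_smul[of v]]] by simp
  from has_derivative_compose[OF this assms(1)] show ?thesis
    by (rule has_derivative_imp_has_field_derivative) (simp add: assms(2))
qed

lemma holomorphic_on_line:
  assumes "holomorphic_wrt smul f U" "\<And>\<zeta>. \<zeta> \<in> A \<Longrightarrow> a + smul \<zeta> v \<in> U"
  shows "(\<lambda>\<zeta>. f (a + smul \<zeta> v)) holomorphic_on A"
proof (unfold holomorphic_on_def, safe)
  fix \<zeta> assume "\<zeta> \<in> A"
  with assms obtain f' where "(f has_derivative f') (at (a + smul \<zeta> v))"
    "\<And>c v. f' (smul c v) = c * f' v"
    unfolding holomorphic_wrt_def by blast
  from has_field_derivative_on_line[OF this]
  show "(\<lambda>\<zeta>. f (a + smul \<zeta> v)) field_differentiable at \<zeta> within A"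
    by (meson field_differentiable_at_within field_differentiable_def)
qed

lemma holomorphic_wrt_continuous_on:
  assumes "holomorphic_wrt smul f U"
  shows "continuous_on U f"
  using assms unfolding holomorphic_wrt_def
  by (meson continuous_at_imp_continuous_on has_derivative_continuous)

text \<open>The interior \<open>A\<close> of the zero set is relatively closed in \<open>U\<close>:
  near a limit point of \<open>A\<close>, every point lies on a complex line through a point of
  \<open>A\<close>, where the one-variable identity theorem applies. Connectedness does the
  rest.\<close>

lemma holomorphic_wrt_identity:
  assumes hol: "holomorphic_wrt smul f U" and U: "open U" "connected U"
    and V: "open V" "V \<noteq> {}" "V \<subseteq> U" "\<And>p. p \<in> V \<Longrightarrow> f p = 0" and "p \<in> U"
  shows "f p = 0"
proof -
  define A where "A = interior {q \<in> U. f q = 0}"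
  have AU: "A \<subseteq> U" and Az: "\<And>q. q \<in> A \<Longrightarrow> f q = 0"
    using interior_subset unfolding A_def by fastforce+
  have cl: "q \<in> A" if q: "q \<in> U" "q \<in> closure A" for q
  proof -
    obtain e where e: "e > 0" "ball q e \<subseteq> U"
      using U q open_contains_ball by blast
    obtain a where a: "a \<in> A" "dist a q < e"
      using q e closure_approachable by blast
    have "f x = 0" if x: "x \<in> ball q e" for x
    proof -
      \<comment> \<open>\<open>T\<close> holds the parameters of the complex line through
        \<open>a\<close> (at 0) and \<open>x\<close> (at 1) that stay in the ball; on the open
        subset \<open>T \<inter> T'\<close> the function is known to vanish.\<close>
      define T where "T = (\<lambda>\<zeta>. a + smul \<zeta> (x - a)) -` ball q e"
      define T' where "T' = (\<lambda>\<zeta>. a + smul \<zeta> (x - a)) -` A"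
      have lin: "linear (\<lambda>\<zeta>. smul \<zeta> (x - a))"
        using bounded_linear_smul bounded_linear.linear by blast
      have cont: "continuous_on UNIV (\<lambda>\<zeta>. a + smul \<zeta> (x - a))"
        by (intro continuous_intros linear_continuous_on bounded_linear_smul)
      have oT: "open T"
        unfolding T_def using cont by (simp add: continuous_on_open_vimage)
      have oT': "open T'"
        unfolding T'_def using cont by (simp add: continuous_on_open_vimage A_def)
      \<comment> \<open>As the preimage of a translated ball under a linear map, \<open>T\<close> is
        convex and hence connected.\<close>
      have "T = (\<lambda>\<zeta>. smul \<zeta> (x - a)) -` ((+) (- a) ` ball q e)"
        unfolding T_def by (force simp: image_iff)
      then have "convex T"
        using convex_linear_vimage[OF lin] convex_translation[OF convex_ball] by metis
      then have "connected T" by (rule convex_connected)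
      have hT: "(\<lambda>\<zeta>. f (a + smul \<zeta> (x - a))) holomorphic_on T"
        using e by (intro holomorphic_on_line[OF hol]) (auto simp: T_def)
      have "f (a + smul 1 (x - a)) = 0"
      proof (rule analytic_continuation_open[OF _ oT _ \<open>connected T\<close> _ hT])
        show "open (T \<inter> T')" using oT oT' by blast
        have "0 \<in> T \<inter> T'" using a by (simp add: T_def T'_def dist_commute)
        then show "T \<inter> T' \<noteq> {}" by blast
        show "1 \<in> T" using x by (simp add: T_def)
      qed (use Az in \<open>auto simp: T'_def\<close>)
      then show ?thesis by simp
    qed
    then have "ball q e \<subseteq> A"
      unfolding A_def using e by (intro interior_maximal) auto
    then show ?thesis using e by auto
  qed
  have "V \<subseteq> A"
    unfolding A_def using V by (intro interior_maximal) auto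
  \<comment> \<open>By \<open>cl\<close>, the open sets \<open>A\<close> and
    \<open>- closure A\<close> cover \<open>U\<close>, so one of them misses \<open>U\<close>; it is
    not \<open>A\<close>, which contains the nonempty \<open>V\<close>.\<close>
  have "A \<inter> U = {} \<or> - closure A \<inter> U = {}"
    using U cl closure_subset by (intro connectedD) (auto simp: A_def)
  then have "U \<subseteq> A" using \<open>V \<subseteq> A\<close> V cl by blast
  then show ?thesis using Az assms by blast
qed

text \<open>Cauchy's estimate for the first derivative of the one-variable function obtained by
  moving from \<open>x\<close> in direction \<open>h\<close>.\<close>

lemma derivative_bound:
  assumes hol: "holomorphic_wrt smul f (ball p (2 * \<rho>))" and "\<rho> > 0"
    and bound: "\<And>q. q \<in> ball p (2 * \<rho>) \<Longrightarrow> norm (f q) \<le> M"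
    and x: "x \<in> ball p \<rho>"
    and f': "(f has_derivative f') (at x)" "\<And>c v. f' (smul c v) = c * f' v"
  shows "norm (f' h) \<le> M / \<rho> * norm h"
proof (cases "h = 0")
  case True
  then show ?thesis using f'(2)[of 0 h] by simp
next
  case False
  \<comment> \<open>The radius for which displacements \<open>smul \<zeta> h\<close> have norm at
    most \<open>\<rho>\<close>; starting in \<open>ball p \<rho>\<close>, they stay inside the ball
    of radius \<open>2 * \<rho>\<close>.\<close>
  define r where "r = \<rho> / norm h"
  have r: "r > 0" using False \<open>\<rho> > 0\<close> by (simp add: r_def)
  define g where "g \<zeta> = f (x + smul \<zeta> h)" for \<zeta>
  have inb: "x + smul \<zeta> h \<in> ball p (2 * \<rho>)" if "\<zeta> \<in> cball 0 r" for \<zeta>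
  proof -
    have "norm (smul \<zeta> h) \<le> \<rho>"
      using that False by (simp add: norm_smul r_def field_simps)
    moreover have "dist p (x + smul \<zeta> h) \<le> dist p x + norm (smul \<zeta> h)"
      by (metis add_diff_cancel_left' dist_norm dist_triangle norm_minus_commute)
    ultimately show ?thesis using x by simp
  qed
  have "g holomorphic_on cball 0 r"
    unfolding g_def using inb by (rule holomorphic_on_line[OF hol])
  then have "norm ((deriv ^^ 1) g 0) \<le> fact 1 * M / r ^ 1"
    using r bound inb
    by (intro Cauchy_inequality)
       (auto simp: g_def[symmetric] intro: holomorphic_on_subset holomorphic_on_imp_continuous_on
         intro!: bound[OF inb, folded g_def])
  moreover have "deriv g 0 = f' h"
    unfolding g_def using has_field_derivative_on_line[of f f' x 0 h] f'
    by (intro DERIV_imp_deriv) simp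
  ultimately show ?thesis by (simp add: r_def field_simps)
qed

text \<open>Weierstrass' theorem: Cauchy's estimate on a smaller ball turns the majorant of the
  terms into one of their derivatives, so the series may be differentiated termwise, and complex
  linearity passes to the sum.\<close>

lemma holomorphic_wrt_suminf:
  assumes hol: "\<And>n. holomorphic_wrt smul (f n) U" and "open U"
    and loc: "\<And>p. p \<in> U \<Longrightarrow> \<exists>e>0. \<exists>M. summable M \<and> (\<forall>n. \<forall>q\<in>ball p e. norm (f n q) \<le> M n)"
  shows "holomorphic_wrt smul (\<lambda>q. \<Sum>n. f n q) U"
  unfolding holomorphic_wrt_def
proof
  fix p assume p: "p \<in> U"
  obtain e1 M where e1: "e1 > 0" "summable M" "\<And>n q. q \<in> ball p e1 \<Longrightarrow> norm (f n q) \<le> M n"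
    using loc[OF p] by blast
  obtain e2 where e2: "e2 > 0" "ball p e2 \<subseteq> U"
    using \<open>open U\<close> p open_contains_ball by blast
  \<comment> \<open>Halved because \<open>derivative_bound\<close> on \<open>ball p \<rho>\<close>
    needs the bound on the ball of twice the radius.\<close>
  define \<rho> where "\<rho> = min e1 e2 / 2"
  have \<rho>: "\<rho> > 0" "ball p (2 * \<rho>) \<subseteq> U" "ball p (2 * \<rho>) \<subseteq> ball p e1"
    using e1 e2 by (auto simp: \<rho>_def)
  have sub: "ball p \<rho> \<subseteq> ball p (2 * \<rho>)" using \<rho> by auto
  have hol2: "holomorphic_wrt smul (f n) (ball p (2 * \<rho>))" for n
    using hol[of n] \<rho>(2) unfolding holomorphic_wrt_def by blast
  have "\<forall>n x. \<exists>D. x \<in> ball p \<rho> \<longrightarrow> (f n has_derivative D) (at x) \<and> (\<forall>c v. D (smul c v) = c * D v)"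
    using hol2 sub unfolding holomorphic_wrt_def by blast
  then obtain f' where
      f': "\<And>n x. x \<in> ball p \<rho> \<Longrightarrow> (f n has_derivative f' n x) (at x)"
      "\<And>n x c v. x \<in> ball p \<rho> \<Longrightarrow> f' n x (smul c v) = c * f' n x v"
    by metis
  have bd: "norm (f' n x h) \<le> M n / \<rho> * norm h" if "x \<in> ball p \<rho>" for n x h
    using derivative_bound[OF hol2 \<rho>(1) _ that f'(1)[OF that] f'(2)[OF that]] e1(3) \<rho>(3)
    by blast
  have summ: "summable (\<lambda>n. M n / \<rho> * norm h)" for h :: 'a
    using e1(2) by (intro summable_mult2 summable_divide)
  have sf': "summable (\<lambda>n. f' n x h)" if "x \<in> ball p \<rho>" for x h
    by (rule summable_comparison_test'[OF summ]) (rule bd[OF that])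
  define g' where "g' x h = (\<Sum>n. f' n x h)" for x h
  have "\<exists>g. \<forall>x\<in>ball p \<rho>. (\<lambda>n. f n x) sums g x \<and> (g has_derivative g' x) (at x within ball p \<rho>)"
  proof (rule has_derivative_series)
    show "(f n has_derivative f' n x) (at x within ball p \<rho>)" if "x \<in> ball p \<rho>" for n x
      using f'(1)[OF that] has_derivative_at_withinI by blast
    have "summable (\<lambda>n. f n p)"
      using e1 by (intro summable_comparison_test'[OF e1(2)]) auto
    then show "(\<lambda>n. f n p) sums (\<Sum>n. f n p)" by (rule summable_sums)
    show "p \<in> ball p \<rho>" using \<rho> by simp
    fix e :: real assume "e > 0"
    \<comment> \<open>The tail of the majorant depends neither on the point \<open>x\<close> nor on
      the direction \<open>h\<close>, which gives the uniformity required.\<close>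
    obtain N where N: "\<And>n. n \<ge> N \<Longrightarrow> norm (\<Sum>i. M (i + n) / \<rho>) < e"
      using suminf_exist_split[OF \<open>e > 0\<close> summable_divide[OF e1(2), of \<rho>]] by blast
    have "norm ((\<Sum>i<n. f' i x h) - g' x h) \<le> e * norm h"
      if n: "n \<ge> N" and x: "x \<in> ball p \<rho>" for n x h
    proof -
      have "norm ((\<Sum>i<n. f' i x h) - g' x h) = norm (\<Sum>i. f' (i + n) x h)"
        unfolding g'_def using suminf_split_initial_segment[OF sf'[OF x], of h n]
        by (simp add: norm_minus_commute)
      also have "\<dots> \<le> (\<Sum>i. M (i + n) / \<rho> * norm h)"
        using bd[OF x] summable_ignore_initial_segment[OF summ]
        by (intro norm_suminf_le) auto
      also have "\<dots> = (\<Sum>i. M (i + n) / \<rho>) * norm h"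
        using summable_ignore_initial_segment[OF e1(2)]
        by (intro suminf_mult2[symmetric] summable_divide)
      also have "\<dots> \<le> e * norm h"
        using N[OF n] by (intro mult_right_mono) auto
      finally show ?thesis .
    qed
    then show "\<forall>\<^sub>F n in sequentially. \<forall>x\<in>ball p \<rho>. \<forall>h.
        norm ((\<Sum>i<n. f' i x h) - g' x h) \<le> e * norm h"
      unfolding eventually_sequentially by blast
  qed simp
  then obtain g where g: "\<And>x. x \<in> ball p \<rho> \<Longrightarrow> (\<lambda>n. f n x) sums g x"
    "\<And>x. x \<in> ball p \<rho> \<Longrightarrow> (g has_derivative g' x) (at x within ball p \<rho>)" by blast
  have pb: "p \<in> ball p \<rho>" using \<rho> by simp
  have "(g has_derivative g' p) (at p)"
    using g(2)[OF pb] at_within_open[OF pb] by simp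
  then have "((\<lambda>q. \<Sum>n. f n q) has_derivative g' p) (at p)"
    by (rule has_derivative_transform_within_open[of _ _ _ _ "ball p \<rho>"])
       (use g(1) sums_unique pb in auto)
  moreover have "g' p (smul c v) = c * g' p v" for c v
    unfolding g'_def using f'(2)[OF pb] suminf_mult[OF sf'[OF pb]] by simp
  ultimately show "\<exists>D. ((\<lambda>q. \<Sum>n. f n q) has_derivative D) (at p) \<and>
      (\<forall>c v. D (smul c v) = c * D v)" by blast
qed

end

interpretation vec: complex_scaling "(*s) :: complex \<Rightarrow> complex^'N \<Rightarrow> complex^'N"
  by unfold_locales
    (simp_all add: vec_eq_iff scaleR_conv_of_real[where 'a = complex] distrib_right
      norm_vector_smult mult.assoc)

interpretation prod: complex_scaling "smul_prod :: complex \<Rightarrow> (complex^'N) \<times> complex \<Rightarrow> _"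
  by unfold_locales
    (simp_all add: norm_smul_prod, simp_all add: smul_prod_def vec_eq_iff prod_eq_iff
      scaleR_conv_of_real[where 'a = complex] distrib_right mult.assoc)

section \<open>Roots of polynomials and zero-free circles\<close>

text \<open>The leading coefficient is \<open>a 0\<close>. The bound sees the coefficients only
  through \<open>\<delta>\<close> and \<open>M\<close>, hence is uniform over families of
  polynomials.\<close>

lemma polynomial_root_bound:
  fixes a :: "nat \<Rightarrow> complex"
  assumes "t \<ge> 1" and root: "(\<Sum>j\<le>t. a j * x ^ (t - j)) = 0"
    and "\<delta> > 0" "\<delta> \<le> norm (a 0)" and M: "\<And>j. j \<le> t \<Longrightarrow> norm (a j) \<le> M"
  shows "norm x \<le> 1 + t * M / \<delta>"
proof -
  have "0 \<le> M" using M[of 0] norm_ge_zero order_trans by blast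
  show ?thesis
  proof (cases "norm x \<le> 1")
    case True
    then show ?thesis using \<open>0 \<le> M\<close> \<open>\<delta> > 0\<close> by (simp add: add_increasing2)
  next
    case False
    have "a 0 * x ^ t + (\<Sum>j\<in>{1..t}. a j * x ^ (t - j)) = 0"
      using root by (simp add: atMost_atLeast0 sum.atLeast_Suc_atMost)
    then have "a 0 * x ^ t = - (\<Sum>j\<in>{1..t}. a j * x ^ (t - j))"
      by (rule eq_neg_iff_add_eq_0[THEN iffD2])
    then have "norm (a 0) * norm x ^ t = norm (\<Sum>j\<in>{1..t}. a j * x ^ (t - j))"
      by (metis norm_minus_cancel norm_mult norm_power)
    \<comment> \<open>Since \<open>norm x > 1\<close>, all powers below the leading one are
      dominated by \<open>norm x ^ (t - 1)\<close>, which is cancelled later.\<close>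
    also have "\<dots> \<le> (\<Sum>j\<in>{1..t}. M * norm x ^ (t - 1))"
      using False M by (intro sum_norm_le) (auto simp: norm_mult norm_power intro!: mult_mono power_increasing \<open>0 \<le> M\<close>)
    also have "\<dots> = t * M * norm x ^ (t - 1)" by simp
    finally have "norm (a 0) * norm x ^ t \<le> t * M * norm x ^ (t - 1)" .
    moreover have "\<delta> * norm x ^ t \<le> norm (a 0) * norm x ^ t"
      using assms by (intro mult_right_mono) auto
    moreover have "norm x ^ t = norm x * norm x ^ (t - 1)"
      using \<open>t \<ge> 1\<close> by (cases t) auto
    ultimately have "(\<delta> * norm x) * norm x ^ (t - 1) \<le> (t * M) * norm x ^ (t - 1)"
      by (simp add: mult.assoc)
    moreover have "norm x ^ (t - 1) > 0" using False by (intro zero_less_power) linarith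
    ultimately have "\<delta> * norm x \<le> t * M" by (simp only: mult_le_cancel_right_pos)
    then have "norm x \<le> t * M / \<delta>" using \<open>\<delta> > 0\<close> by (simp add: field_simps)
    then show ?thesis by simp
  qed
qed

text \<open>A nonconstant \<open>f\<close> has finitely many zeros in the compact disc, so their
  moduli cannot fill the interval between \<open>a\<close> and \<open>b\<close>. A constant
  \<open>f\<close> is nonzero because of the point \<open>w\<close>.\<close>

lemma zero_free_circle:
  assumes f: "f holomorphic_on S" "open S" "connected S" and "cball 0 b \<subseteq> S"
    and "w \<in> S" "f w \<noteq> 0" and "0 \<le> a" "a < b"
  obtains r where "a < r" "r < b" "\<And>\<zeta>. norm \<zeta> = r \<Longrightarrow> f \<zeta> \<noteq> 0"
proof (cases "f constant_on S")
  case True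
  then obtain c where c: "\<And>\<zeta>. \<zeta> \<in> S \<Longrightarrow> f \<zeta> = c" unfolding constant_on_def by blast
  obtain r where r: "a < r" "r < b" using dense \<open>a < b\<close> by blast
  have "f \<zeta> \<noteq> 0" if "norm \<zeta> = r" for \<zeta>
    using c[of \<zeta>] c[of w] assms that r by (auto simp: subset_iff)
  with r that show ?thesis by blast
next
  case False
  have "finite {\<zeta> \<in> cball 0 b. f \<zeta> = 0}"
    using f assms False by (intro holomorphic_compact_finite_zeros) auto
  then have "infinite ({a<..<b} - norm ` {\<zeta> \<in> cball 0 b. f \<zeta> = 0})"
    using \<open>a < b\<close> by (intro Diff_infinite_finite) (auto simp: infinite_Ioo)
  then obtain r where "r \<in> {a<..<b} - norm ` {\<zeta> \<in> cball 0 b. f \<zeta> = 0}"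
    using infinite_imp_nonempty by blast
  then show ?thesis by (intro that[of r]) force+
qed

section \<open>Specialisation of the coefficients at a point\<close>

text \<open>Specialisation at \<open>z\<close> is a ring homomorphism, which is what allows the
  algebraic equation for \<open>F\<close> to be read at a single point.\<close>

lemma fps_at_simps:
  "fps_at 0 z = 0" "fps_at 1 z = 1" "fps_at (G + H) z = fps_at G z + fps_at H z"
  "fps_at (G * H) z = fps_at G z * fps_at H z"
proof -
  have sum_apply: "(\<Sum>i\<in>A. h i) z = (\<Sum>i\<in>A. h i z)" for h :: "nat \<Rightarrow> 'a \<Rightarrow> complex" and A
    by (induction A rule: infinite_finite_induct) auto
  show "fps_at (G * H) z = fps_at G z * fps_at H z"
    by (simp add: fps_at_def fps_eq_iff fps_mult_nth sum_apply)
qed (simp_all add: fps_at_def fps_eq_iff fps_one_nth)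

lemma fps_at_power: "fps_at (G ^ n) z = fps_at G z ^ n"
  by (induction n) (simp_all add: fps_at_simps)

lemma fps_at_sum: "fps_at (\<Sum>i\<in>A. G i) z = (\<Sum>i\<in>A. fps_at (G i) z)"
  by (induction A rule: infinite_finite_induct) (simp_all add: fps_at_simps)

lemma fps_at_w_expansion: "fps_at (w_expansion g) z = fps_expansion (\<lambda>w. g (z, w)) 0"
  by (simp add: fps_at_def w_expansion_def fps_eq_iff)

lemma cball_subset_eball: "ereal r < R \<Longrightarrow> cball 0 r \<subseteq> eball (0 :: complex) R"
  by (cases R) auto

section \<open>The algebraic equation on the slices over \<open>S\<close>\<close>

text \<open>Fixes witnesses \<open>S\<close>, \<open>t\<close>, \<open>\<Phi>\<close> for (C1) and
  (C2). The set \<open>eball 0 R\<close> is the disc or, for infinite \<open>R\<close>, the whole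
  plane.\<close>

locale algebraic_series =
  fixes D1 :: "(complex^'N) set" and R :: ereal and F :: "(complex^'N \<Rightarrow> complex) fps"
    and S :: "(complex^'N) set" and t :: nat
    and \<Phi> :: "nat \<Rightarrow> (complex^'N) \<times> complex \<Rightarrow> complex"
  assumes D1: "open D1" "connected D1"
    and R_pos: "0 < R"
    and coeffs: "\<And>n. holo_N (fps_nth F n) D1"
    and S: "S \<subseteq> D1" "D1 \<subseteq> closure S"
    and summable_S: "\<And>\<alpha> w. \<alpha> \<in> S \<Longrightarrow> w \<in> eball 0 R \<Longrightarrow> summable (\<lambda>n. fps_nth F n \<alpha> * w ^ n)"
    and t: "t \<ge> 1"
    and \<Phi>: "\<And>j. j \<le> t \<Longrightarrow> holo_N1 (\<Phi> j) (D1 \<times> eball 0 R)"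
    and \<Phi>0: "\<exists>p\<in>D1 \<times> eball 0 R. \<Phi> 0 p \<noteq> 0"
    and algebraic: "fps_eq_on D1 (\<Sum>j\<le>t. w_expansion (\<Phi> j) * F ^ (t - j)) 0"
begin

lemma zero_in_eball: "(0 :: complex) \<in> eball 0 R"
  using R_pos by (simp add: zero_ereal_def)

lemma \<Phi>_slice_holomorphic:
  assumes "z \<in> D1" "j \<le> t"
  shows "(\<lambda>w. \<Phi> j (z, w)) holomorphic_on eball 0 R"
proof -
  have "(\<lambda>w. \<Phi> j ((z, 0) + smul_prod w (0, 1))) holomorphic_on eball 0 R"
    using \<Phi>[OF assms(2)] unfolding holo_N1_def
    by (rule prod.holomorphic_on_line) (use assms(1) in \<open>auto simp: smul_prod_def\<close>)
  then show ?thesis by (simp add: smul_prod_def)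
qed

lemma conv_radius_S:
  assumes "\<alpha> \<in> S"
  shows "R \<le> fps_conv_radius (fps_at F \<alpha>)"
  unfolding fps_conv_radius_def
  using summable_S[OF assms] by (intro conv_radius_geI_ex') (simp add: fps_at_def)

lemma eval_S_holomorphic:
  assumes "\<alpha> \<in> S"
  shows "eval_fps (fps_at F \<alpha>) holomorphic_on eball 0 R"
  using conv_radius_S[OF assms] by (intro holomorphic_on_eval_fps) (auto simp: order_less_le_trans)

text \<open>The left side is holomorphic in \<open>w\<close>, and its expansion at 0 is the formal
  equation specialised at \<open>\<alpha>\<close>, hence zero; the identity theorem extends this to
  the whole disc.\<close>

lemma algebraic_equation:
  assumes \<alpha>: "\<alpha> \<in> S" and w: "w \<in> eball 0 R"
  shows "(\<Sum>j\<le>t. \<Phi> j (\<alpha>, w) * eval_fps (fps_at F \<alpha>) w ^ (t - j)) = 0"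
proof (rule has_fps_expansion_0_analytic_continuation[OF _ _ open_eball connected_eball zero_in_eball w])
  have \<alpha>1: "\<alpha> \<in> D1" using \<alpha> S by blast
  have "(\<lambda>w. \<Sum>j\<le>t. \<Phi> j (\<alpha>, w) * eval_fps (fps_at F \<alpha>) w ^ (t - j)) has_fps_expansion
      (\<Sum>j\<le>t. fps_expansion (\<lambda>w. \<Phi> j (\<alpha>, w)) 0 * fps_at F \<alpha> ^ (t - j))"
    using \<Phi>_slice_holomorphic[OF \<alpha>1] zero_in_eball conv_radius_S[OF \<alpha>] R_pos
    by (intro has_fps_expansion_sum has_fps_expansion_mult has_fps_expansion_power
        eval_fps_has_fps_expansion has_fps_expansion_fps_expansion[of "eball 0 R"])
      (auto intro: less_le_trans)
  also have "(\<Sum>j\<le>t. fps_expansion (\<lambda>w. \<Phi> j (\<alpha>, w)) 0 * fps_at F \<alpha> ^ (t - j)) =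
      fps_at (\<Sum>j\<le>t. w_expansion (\<Phi> j) * F ^ (t - j)) \<alpha>"
    by (simp add: fps_at_sum fps_at_simps fps_at_power fps_at_w_expansion)
  also have "\<dots> = 0"
    using algebraic \<alpha>1 unfolding fps_eq_on_def by (simp add: fps_at_def fps_eq_iff)
  finally show "(\<lambda>w. \<Sum>j\<le>t. \<Phi> j (\<alpha>, w) * eval_fps (fps_at F \<alpha>) w ^ (t - j)) has_fps_expansion 0" .
  show "(\<lambda>w. \<Sum>j\<le>t. \<Phi> j (\<alpha>, w) * eval_fps (fps_at F \<alpha>) w ^ (t - j)) holomorphic_on eball 0 R"
    using \<Phi>_slice_holomorphic[OF \<alpha>1] eval_S_holomorphic[OF \<alpha>]
    by (intro holomorphic_on_sum holomorphic_on_mult holomorphic_on_power) auto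
qed

section \<open>Locally uniform bounds for the coefficients\<close>

text \<open>A Cauchy estimate uniform near \<open>z0\<close>. The product form, rather than
  \<open>C / r ^ n\<close>, keeps it meaningful at \<open>r = 0\<close>, where only the constant
  coefficient is bounded.\<close>

definition coeff_bound :: "complex^'N \<Rightarrow> real \<Rightarrow> bool" where
  "coeff_bound z0 r \<longleftrightarrow>
    (\<exists>e>0. \<exists>C. \<forall>z\<in>ball z0 e. \<forall>n. norm (fps_nth F n z) * r ^ n \<le> C)"

lemma coeff_bound_mono:
  assumes "coeff_bound z0 r'" "0 \<le> r" "r \<le> r'"
  shows "coeff_bound z0 r"
proof -
  have "norm (fps_nth F n z) * r ^ n \<le> norm (fps_nth F n z) * r' ^ n" for n z
    using assms by (intro mult_left_mono power_mono) auto
  then show ?thesis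
    using assms(1) unfolding coeff_bound_def by (meson order_trans)
qed

lemma open_D: "open (D1 \<times> eball 0 R)"
  using D1 by (intro open_Times) auto

text \<open>The case where the leading coefficient does not vanish identically on the slice over
  \<open>z0\<close>.\<close>

lemma coeff_bound_regular:
  assumes z0: "z0 \<in> D1" and w0: "w0 \<in> eball 0 R" "\<Phi> 0 (z0, w0) \<noteq> 0"
    and r0: "0 \<le> r0" "ereal r0 < R"
  shows "coeff_bound z0 r0"
proof -
  \<comment> \<open>The zero-free radius \<open>r\<close> cannot be prescribed, only found between
    \<open>r0\<close> and some \<open>b\<close> below \<open>R\<close>; monotonicity returns to
    \<open>r0\<close> at the end.\<close>
  obtain b where b: "r0 < b" "ereal b < R"
    using ereal_dense2[OF r0(2)] by auto
  have "cball 0 b \<subseteq> eball (0 :: complex) R"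
    using b by (intro cball_subset_eball)
  then obtain r where r: "r0 < r" "r < b" "\<And>w. norm w = r \<Longrightarrow> \<Phi> 0 (z0, w) \<noteq> 0"
    using zero_free_circle[OF \<Phi>_slice_holomorphic[OF z0] open_eball connected_eball _ w0 r0(1) b(1)]
    by auto
  have rpos: "r > 0" and rR: "ereal r < R"
    using r r0 b by (auto intro: less_trans[of "ereal r" "ereal b" R])
  have cont: "continuous_on (D1 \<times> eball 0 R) (\<Phi> j)" if "j \<le> t" for j
    using \<Phi>[OF that] unfolding holo_N1_def by (rule prod.holomorphic_wrt_continuous_on)
  define V where "V = {p \<in> D1 \<times> eball 0 R. \<Phi> 0 p \<noteq> 0}"
  have "V = (D1 \<times> eball 0 R) \<inter> \<Phi> 0 -` (- {0})" by (auto simp: V_def)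
  then have "open V"
    using continuous_open_preimage[OF cont[of 0] open_D, of "- {0}"] by auto
  have "{z0} \<times> sphere 0 r \<subseteq> V"
    using z0 rR r by (auto simp: V_def)
  then obtain e where e: "e > 0" "(\<Union>p\<in>{z0} \<times> sphere 0 r. cball p e) \<subseteq> V"
    using compact_subset_open_imp_cball_epsilon_subset[OF _ \<open>open V\<close>, of "{z0} \<times> sphere 0 r"]
      compact_Times[OF compact_sing compact_sphere, of z0 0 r] by blast
  \<comment> \<open>A compact tube around the circle. Each of its points is within \<open>e\<close>
    of the point over \<open>z0\<close> with the same second coordinate, so \<open>\<Phi> 0\<close>
    has no zero on it.\<close>
  define K where "K = cball z0 e \<times> sphere (0 :: complex) r"
  have "compact K" unfolding K_def by (intro compact_Times) auto
  have "K \<subseteq> V"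
  proof
    fix p assume "p \<in> K"
    then have "p \<in> cball (z0, snd p) e" "(z0, snd p) \<in> {z0} \<times> sphere 0 r"
      by (auto simp: K_def dist_prod_def)
    then show "p \<in> V" using e by blast
  qed
  have "K \<noteq> {}" using e rpos by (auto simp: K_def)
  have contK: "continuous_on K (\<lambda>p. norm (\<Phi> j p))" if "j \<le> t" for j
    using \<open>K \<subseteq> V\<close> by (intro continuous_on_norm continuous_on_subset[OF cont[OF that]])
      (auto simp: V_def)
  obtain p0 where p0: "p0 \<in> K" "\<And>p. p \<in> K \<Longrightarrow> norm (\<Phi> 0 p0) \<le> norm (\<Phi> 0 p)"
    using continuous_attains_inf[OF \<open>compact K\<close> \<open>K \<noteq> {}\<close> contK[of 0]] by auto
  define \<delta> where "\<delta> = norm (\<Phi> 0 p0)"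
  have "\<delta> > 0" using p0 \<open>K \<subseteq> V\<close> by (auto simp: \<delta>_def V_def)
  have "compact ((\<lambda>p. norm (\<Phi> j p)) ` K)" if "j \<le> t" for j
    using contK[OF that] \<open>compact K\<close> by (rule compact_continuous_image)
  then have "bounded (\<Union>j\<le>t. (\<lambda>p. norm (\<Phi> j p)) ` K)"
    by (intro bounded_UN) (auto intro: compact_imp_bounded)
  then obtain M where M: "\<And>j p. j \<le> t \<Longrightarrow> p \<in> K \<Longrightarrow> norm (\<Phi> j p) \<le> M"
    unfolding bounded_iff by fastforce
  \<comment> \<open>The root bound with the minimum of \<open>norm (\<Phi> 0 p)\<close> and a common
    bound of all coefficients over the tube; it depends neither on \<open>\<alpha>\<close> nor on
    \<open>n\<close>.\<close>
  define C where "C = 1 + t * M / \<delta>"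
  have bound_S: "norm (fps_nth F n \<alpha>) * r ^ n \<le> C" if \<alpha>: "\<alpha> \<in> S" "\<alpha> \<in> cball z0 e" for n \<alpha>
  proof -
    let ?f = "eval_fps (fps_at F \<alpha>)"
    have sub: "cball 0 r \<subseteq> eball (0 :: complex) R"
      using rR by (rule cball_subset_eball)
    have hol: "?f holomorphic_on cball 0 r"
      using eval_S_holomorphic[OF \<alpha>(1)] sub by (rule holomorphic_on_subset)
    have "norm ((deriv ^^ n) ?f 0) \<le> fact n * C / r ^ n"
    proof (rule Cauchy_inequality)
      show "?f holomorphic_on ball 0 r" using hol by (rule holomorphic_on_subset) auto
      show "continuous_on (cball 0 r) ?f" using hol by (rule holomorphic_on_imp_continuous_on)
      fix w :: complex assume "norm (0 - w) = r"
      then have w: "(\<alpha>, w) \<in> K" "w \<in> eball 0 R" using \<alpha> sub by (auto simp: K_def)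
      show "norm (?f w) \<le> C"
        unfolding C_def
        by (rule polynomial_root_bound[OF t algebraic_equation[OF \<alpha>(1) w(2)] \<open>\<delta> > 0\<close>])
          (use w p0 M in \<open>auto simp: \<delta>_def\<close>)
    qed (use rpos in auto)
    moreover have "fps_nth (fps_at F \<alpha>) n = (deriv ^^ n) ?f 0 / fact n"
      using conv_radius_S[OF \<alpha>(1)] R_pos
      by (intro fps_nth_fps_expansion eval_fps_has_fps_expansion) (rule less_le_trans)
    then have "norm (fps_nth F n \<alpha>) = norm ((deriv ^^ n) ?f 0) / fact n"
      by (simp add: norm_divide fps_at_def[of F \<alpha>])
    ultimately have "norm (fps_nth F n \<alpha>) \<le> C / r ^ n"
      by (simp add: divide_le_eq mult.commute)
    then show ?thesis
      using rpos by (simp add: pos_le_divide_eq)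
  qed
  obtain e' where e': "e' > 0" "ball z0 e' \<subseteq> D1"
    using D1 z0 open_contains_ball by blast
  have "norm (fps_nth F n z) * r ^ n \<le> C" if z: "z \<in> ball z0 (min e e')" for z n
  proof -
    let ?B = "ball z0 (min e e')"
    let ?h = "\<lambda>z. norm (fps_nth F n z) * r ^ n"
    have "continuous_on ?B ?h"
      using coeffs[of n] e' unfolding holo_N_def
      by (intro continuous_intros continuous_on_subset[OF vec.holomorphic_wrt_continuous_on]) auto
    \<comment> \<open>Density of \<open>S\<close> localises to the open ball, so each
      \<open>z\<close> in it is a limit of points satisfying \<open>bound_S\<close>, and continuity
      of the coefficients carries the bound over.\<close>
    have "?B \<subseteq> closure (?B \<inter> S)"
    proof -
      have "?B \<subseteq> closure S" using e' S by auto
      then have "?B \<subseteq> ?B \<inter> closure S" by blast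
      also have "\<dots> \<subseteq> closure (?B \<inter> S)" by (rule open_Int_closure_subset) simp
      finally show ?thesis .
    qed
    with z have "z \<in> closure (?B \<inter> S)" by blast
    then obtain x where x: "\<And>k. x k \<in> ?B \<inter> S" "x \<longlonglongrightarrow> z"
      unfolding closure_sequential by blast
    have "(\<lambda>k. ?h (x k)) \<longlonglongrightarrow> ?h z"
      using continuous_on_tendsto_compose[OF \<open>continuous_on ?B ?h\<close> x(2) z] x(1) by auto
    moreover have "?h (x k) \<le> C" for k
      using x(1)[of k] by (intro bound_S) auto
    ultimately show ?thesis
      by (intro LIMSEQ_le_const2) auto
  qed
  then have "coeff_bound z0 r"
    unfolding coeff_bound_def using e e'
    by (intro exI[of _ "min e e'"] conjI exI[of _ C]) auto
  then show ?thesis using r0(1) r(1) by (rule coeff_bound_mono[OF _ _ less_imp_le])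
qed

lemma coeff_bound:
  assumes z0: "z0 \<in> D1" and r: "0 \<le> r" "ereal r < R"
  shows "coeff_bound z0 r"
proof (cases "\<forall>w\<in>eball 0 R. \<Phi> 0 (z0, w) = 0")
  case False
  then show ?thesis using coeff_bound_regular assms by blast
next
  case True
  obtain d where d: "d > 0" "ball z0 d \<subseteq> D1"
    using D1 z0 open_contains_ball by blast
  \<comment> \<open>Otherwise the identity theorem would make \<open>\<Phi> 0\<close> vanish on all
    of \<open>D1 \<times> eball 0 R\<close>.\<close>
  have "\<exists>p\<in>ball z0 d \<times> eball 0 R. \<Phi> 0 p \<noteq> 0"
  proof (rule ccontr)
    assume *: "\<not> ?thesis"
    have "\<Phi> 0 p = 0" if p: "p \<in> D1 \<times> eball 0 R" for p
    proof (rule prod.holomorphic_wrt_identity[OF _ open_D _ _ _ _ _ p])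
      show "holomorphic_wrt smul_prod (\<Phi> 0) (D1 \<times> eball 0 R)"
        using \<Phi>[of 0] unfolding holo_N1_def by simp
      show "connected (D1 \<times> eball (0 :: complex) R)"
        using D1 by (intro connected_Times connected_eball)
      show "open (ball z0 d \<times> eball (0 :: complex) R)"
        by (intro open_Times open_ball open_eball)
      show "ball z0 d \<times> eball (0 :: complex) R \<noteq> {}"
        using d zero_in_eball centre_in_ball by blast
      show "ball z0 d \<times> eball (0 :: complex) R \<subseteq> D1 \<times> eball 0 R"
        using d by (intro Sigma_mono) auto
      show "\<Phi> 0 q = 0" if "q \<in> ball z0 d \<times> eball 0 R" for q
        using * that by blast
    qed
    then show False using \<Phi>0 by blast
  qed
  then obtain z1 w1 where z1: "z1 \<in> ball z0 d" "w1 \<in> eball 0 R" "\<Phi> 0 (z1, w1) \<noteq> 0" by auto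
  \<comment> \<open>The complex line from \<open>z0\<close> (parameter 0) to \<open>z1\<close>
    (parameter 1). The direction is nonzero because the slice over \<open>z0\<close> vanishes
    identically while that over \<open>z1\<close> does not.\<close>
  define v where "v = z1 - z0"
  have "v \<noteq> 0" using z1 True by (auto simp: v_def)
  define T :: "complex set" where "T = ball 0 (d / norm v)"
  have inT: "z0 + \<zeta> *s v \<in> ball z0 d" if "\<zeta> \<in> T" for \<zeta>
    using that \<open>v \<noteq> 0\<close> by (simp add: T_def dist_norm norm_vector_smult field_simps)
  have sub: "cball 0 1 \<subseteq> T"
  proof -
    have "1 < d / norm v"
      using z1 \<open>v \<noteq> 0\<close> by (simp add: v_def dist_norm norm_minus_commute)
    then show ?thesis by (auto simp: T_def)
  qed
  have "(\<lambda>\<zeta>. \<Phi> 0 ((z0, w1) + smul_prod \<zeta> (v, 0))) holomorphic_on T"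
    using \<Phi>[of 0] unfolding holo_N1_def
    by (rule prod.holomorphic_on_line) (use d inT z1 in \<open>auto simp: smul_prod_def\<close>)
  then have "(\<lambda>\<zeta>. \<Phi> 0 (z0 + \<zeta> *s v, w1)) holomorphic_on T"
    by (simp add: smul_prod_def)
  \<comment> \<open>With \<open>w1\<close> fixed, the zero-free circle is now sought in the line
    parameter; every point of the resulting circle \<open>L\<close> has a slice that is not
    identically zero.\<close>
  then obtain s where s: "0 < s" "s < 1" "\<And>\<zeta>. norm \<zeta> = s \<Longrightarrow> \<Phi> 0 (z0 + \<zeta> *s v, w1) \<noteq> 0"
  proof (rule zero_free_circle[of _ T 1 1 0])
    show "\<Phi> 0 (z0 + 1 *s v, w1) \<noteq> 0" using z1 by (simp add: v_def)
    show "1 \<in> T" using sub by auto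
  qed (use sub in \<open>auto simp: T_def\<close>)
  have line: "continuous_on A (\<lambda>\<zeta>. z0 + \<zeta> *s v)" for A
    by (intro continuous_intros linear_continuous_on vec.bounded_linear_smul)
  define L where "L = (\<lambda>\<zeta>. z0 + \<zeta> *s v) ` sphere 0 s"
  have "compact L" unfolding L_def using line by (intro compact_continuous_image) auto
  have "coeff_bound x r" if "x \<in> L" for x
    using that s inT d sub z1(2) r by (intro coeff_bound_regular[of _ w1]) (auto simp: L_def subset_iff)
  then obtain e C where eC: "\<And>x. x \<in> L \<Longrightarrow> e x > 0"
    "\<And>x z n. x \<in> L \<Longrightarrow> z \<in> ball x (e x) \<Longrightarrow> norm (fps_nth F n z) * r ^ n \<le> C x"
    unfolding coeff_bound_def by metis
  have "L \<subseteq> (\<Union>x\<in>L. ball x (e x))" using eC by force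
  then obtain L' where L': "L' \<subseteq> L" "finite L'" "L \<subseteq> (\<Union>x\<in>L'. ball x (e x))"
    using compactE_image[OF \<open>compact L\<close>, of L "\<lambda>x. ball x (e x)"] by auto
  define W where "W = (\<Union>x\<in>L'. ball x (e x))"
  \<comment> \<open>A common upper bound for the finitely many constants of the subcover.\<close>
  define B where "B = (\<Sum>x\<in>L'. \<bar>C x\<bar>)"
  have boundW: "norm (fps_nth F n z) * r ^ n \<le> B" if zW: "z \<in> W" for z n
  proof -
    obtain x where x: "x \<in> L'" "z \<in> ball x (e x)" using zW by (auto simp: W_def)
    have "\<bar>C x\<bar> \<le> B" unfolding B_def using x L' by (intro member_le_sum) auto
    then show ?thesis using eC(2)[of x z n] x L' by force
  qed
  have "open W" unfolding W_def by (intro open_UN ballI open_ball)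
  obtain e1 where e1: "e1 > 0" "(\<Union>x\<in>L. ball x e1) \<subseteq> W"
    using compact_subset_open_imp_ball_epsilon_subset[OF \<open>compact L\<close> \<open>open W\<close>] L'(3)
    unfolding W_def by metis
  define L2 where "L2 = (\<lambda>\<zeta>. z0 + \<zeta> *s v) ` cball 0 s"
  have "compact L2" unfolding L2_def using line by (intro compact_continuous_image) auto
  moreover have "L2 \<subseteq> D1"
    using inT d sub s by (auto simp: L2_def subset_iff)
  ultimately obtain e2 where e2: "e2 > 0" "(\<Union>x\<in>L2. ball x e2) \<subseteq> D1"
    using compact_subset_open_imp_ball_epsilon_subset[OF _ D1(1)] by metis
  \<comment> \<open>The disc through \<open>z0\<close> is translated to have centre
    \<open>z\<close>: a shift below \<open>e1\<close> keeps its boundary in \<open>W\<close>, a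
    shift below \<open>e2\<close> keeps all of it in \<open>D1\<close>.\<close>
  have "norm (fps_nth F n z) * r ^ n \<le> B" if z: "z \<in> ball z0 (min e1 e2)" for z n
  proof -
    have dist: "dist (z0 + \<zeta> *s v) (z + \<zeta> *s v) = dist z0 z" for \<zeta>
      by (simp add: dist_norm)
    define g where "g \<zeta> = fps_nth F n (z + \<zeta> *s v) * of_real (r ^ n)" for \<zeta>
    have "z + \<zeta> *s v \<in> D1" if "\<zeta> \<in> cball 0 s" for \<zeta>
    proof -
      have "z + \<zeta> *s v \<in> ball (z0 + \<zeta> *s v) e2" using z dist by simp
      then show ?thesis using e2 that unfolding L2_def by blast
    qed
    then have hol: "g holomorphic_on cball 0 s"
      unfolding g_def using coeffs[of n] unfolding holo_N_def
      by (intro holomorphic_intros vec.holomorphic_on_line)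
    \<comment> \<open>Cauchy's inequality of order 0 is the maximum principle at the centre of the
      disc.\<close>
    have "norm ((deriv ^^ 0) g 0) \<le> fact 0 * B / s ^ 0"
    proof (rule Cauchy_inequality)
      show "g holomorphic_on ball 0 s" using hol by (rule holomorphic_on_subset) auto
      show "continuous_on (cball 0 s) g" using hol by (rule holomorphic_on_imp_continuous_on)
      fix \<zeta> :: complex assume "norm (0 - \<zeta>) = s"
      then have "\<zeta> \<in> sphere 0 s" by simp
      moreover have "z + \<zeta> *s v \<in> ball (z0 + \<zeta> *s v) e1" using z dist by simp
      ultimately have "z + \<zeta> *s v \<in> W" using e1 unfolding L_def by blast
      from boundW[OF this, of n] show "norm (g \<zeta>) \<le> B"
        using r by (simp add: g_def norm_mult norm_power)
    qed (use s in auto)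
    then show ?thesis using r by (simp add: g_def norm_mult norm_power)
  qed
  then show ?thesis
    unfolding coeff_bound_def using e1 e2
    by (intro exI[of _ "min e1 e2"] conjI exI[of _ B]) auto
qed

section \<open>Normal convergence and holomorphy of the sum\<close>

text \<open>With radii \<open>norm (snd p) < \<rho> < r < R\<close>, the coefficient bound at
  \<open>r\<close> and the restriction of the last variable to modulus at most \<open>\<rho>\<close>
  give a geometric majorant of ratio \<open>\<rho> / r\<close>.\<close>

lemma normal_convergence:
  assumes "p \<in> D1 \<times> eball 0 R"
  shows "\<exists>e>0. \<exists>M. summable M \<and>
    (\<forall>n. \<forall>q\<in>ball p e. norm (fps_nth F n (fst q) * snd q ^ n) \<le> M n)"
proof -
  have R': "ereal (norm (snd p)) < R" using assms by auto
  obtain \<rho> where \<rho>: "norm (snd p) < \<rho>" "ereal \<rho> < R" using ereal_dense2[OF R'] by auto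
  obtain r where r: "\<rho> < r" "ereal r < R" using ereal_dense2[OF \<rho>(2)] by auto
  have \<rho>0: "0 < \<rho>" using \<rho> by (meson le_less_trans norm_ge_zero)
  have "coeff_bound (fst p) r" using r \<rho>0 assms by (intro coeff_bound) auto
  then obtain e C where e: "e > 0"
    "\<And>z n. z \<in> ball (fst p) e \<Longrightarrow> norm (fps_nth F n z) * r ^ n \<le> C"
    unfolding coeff_bound_def by blast
  define d where "d = min e (\<rho> - norm (snd p))"
  have "norm (fps_nth F n (fst q) * snd q ^ n) \<le> C * (\<rho> / r) ^ n" if q: "q \<in> ball p d" for n q
  proof -
    have "dist (fst p) (fst q) < d" "dist (snd p) (snd q) < d"
      using q dist_fst_le[of p q] dist_snd_le[of p q] by auto
    then have 1: "fst q \<in> ball (fst p) e" and "dist (snd p) (snd q) < \<rho> - norm (snd p)"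
      by (auto simp: d_def)
    then have 2: "norm (snd q) \<le> \<rho>"
      using norm_triangle_ineq2[of "snd q" "snd p"] by (simp add: dist_norm norm_minus_commute)
    have "norm (fps_nth F n (fst q) * snd q ^ n) \<le> norm (fps_nth F n (fst q)) * \<rho> ^ n"
      using 2 by (simp add: norm_mult norm_power mult_left_mono power_mono)
    also have "\<dots> = norm (fps_nth F n (fst q)) * r ^ n * (\<rho> / r) ^ n"
      using r \<rho>0 by (simp add: power_divide)
    also have "\<dots> \<le> C * (\<rho> / r) ^ n"
      using e(2)[OF 1] r \<rho>0 by (intro mult_right_mono) auto
    finally show ?thesis .
  qed
  moreover have "summable (\<lambda>n. C * (\<rho> / r) ^ n)"
    using r \<rho>0 by (intro summable_mult summable_geometric) auto
  moreover have "d > 0" using e \<rho> by (simp add: d_def)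
  ultimately show ?thesis by blast
qed

lemma summable_D:
  assumes "z \<in> D1" "w \<in> eball 0 R"
  shows "summable (\<lambda>n. fps_nth F n z * w ^ n)"
proof -
  obtain e M where "e > 0" "summable M"
    "\<And>n q. q \<in> ball (z, w) e \<Longrightarrow> norm (fps_nth F n (fst q) * snd q ^ n) \<le> M n"
    using normal_convergence[of "(z, w)"] assms by blast
  from this(1) this(3)[of "(z, w)"] show ?thesis
    by (intro summable_comparison_test'[OF \<open>summable M\<close>]) auto
qed

lemma term_holomorphic: "holo_N1 (\<lambda>q. fps_nth F n (fst q) * snd q ^ n) (D1 \<times> eball 0 R)"
  unfolding holo_N1_def holomorphic_wrt_def
proof
  fix p assume "p \<in> D1 \<times> eball (0 :: complex) R"
  then obtain f' where f': "(fps_nth F n has_derivative f') (at (fst p))"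
    "\<And>c v. f' (c *s v) = c * f' v"
    using coeffs[of n] unfolding holo_N_def holomorphic_wrt_def by fastforce
  have 1: "((\<lambda>q. fps_nth F n (fst q)) has_derivative (\<lambda>h. f' (fst h))) (at p)"
    by (rule has_derivative_compose[OF has_derivative_fst[OF has_derivative_ident] f'(1)])
  have 2: "((\<lambda>q. snd q ^ n) has_derivative (\<lambda>h. of_nat n * snd h * snd p ^ (n - 1))) (at p)"
    by (rule has_derivative_power[OF has_derivative_snd[OF has_derivative_ident]])
  show "\<exists>D. ((\<lambda>q. fps_nth F n (fst q) * snd q ^ n) has_derivative D) (at p) \<and>
      (\<forall>c v. D (smul_prod c v) = c * D v)"
    by (intro exI conjI, rule has_derivative_mult[OF 1 2])
      (simp add: smul_prod_def f'(2) algebra_simps)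
qed

lemma eval_holomorphic: "holo_N1 (\<lambda>(z, w). eval_fps (fps_at F z) w) (D1 \<times> eball 0 R)"
proof -
  have "holomorphic_wrt smul_prod (\<lambda>q. \<Sum>n. fps_nth F n (fst q) * snd q ^ n) (D1 \<times> eball 0 R)"
    using term_holomorphic open_D normal_convergence unfolding holo_N1_def
    by (rule prod.holomorphic_wrt_suminf)
  then show ?thesis
    by (simp add: holo_N1_def eval_fps_def fps_at_def case_prod_unfold)
qed

text \<open>Convergence on the whole disc makes the radius of convergence positive, so the Taylor
  coefficients of the sum at 0 are those of the series.\<close>

lemma w_expansion_eval: "fps_eq_on D1 (w_expansion (\<lambda>(z, w). eval_fps (fps_at F z) w)) F"
  unfolding fps_eq_on_def
proof safe
  fix n z assume z: "z \<in> D1"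
  have "R \<le> fps_conv_radius (fps_at F z)"
    unfolding fps_conv_radius_def
    using summable_D[OF z] by (intro conv_radius_geI_ex') (simp add: fps_at_def)
  then have exp: "eval_fps (fps_at F z) has_fps_expansion fps_at F z"
    using R_pos by (intro eval_fps_has_fps_expansion) (rule less_le_trans)
  show "fps_nth (w_expansion (\<lambda>(z, w). eval_fps (fps_at F z) w)) n z = fps_nth F n z"
    using fps_nth_fps_expansion[OF exp, of n]
    by (simp add: w_expansion_def fps_expansion_def fps_at_def)
qed

end

theorem theorem1:
  fixes D1 :: "(complex^'N) set"
    and R :: ereal
    and F :: "(complex^'N \<Rightarrow> complex) fps"
  defines "D2 \<equiv> {w :: complex. ereal (norm w) < R}"
  defines "D \<equiv> D1 \<times> D2"
  assumes domain_D1: "open D1" "connected D1" "D1 \<noteq> {}"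
    and R_pos: "0 < R"
    and F_coeffs: "\<And>n. holo_N (fps_nth F n) D1"
    and C1: "\<exists>S. S \<subseteq> D1 \<and> D1 \<subseteq> closure S \<and>
      (\<forall>\<alpha>\<in>S. (\<forall>w\<in>D2. summable (\<lambda>n. fps_nth F n \<alpha> * w ^ n)) \<and>
              (\<lambda>w. eval_fps (fps_at F \<alpha>) w) holomorphic_on D2)"
    and C2: "\<exists>t (\<Phi> :: nat \<Rightarrow> (complex^'N) \<times> complex \<Rightarrow> complex).
      t \<ge> 1 \<and> (\<forall>j\<le>t. holo_N1 (\<Phi> j) D) \<and> (\<exists>p\<in>D. \<Phi> 0 p \<noteq> 0) \<and>
      fps_eq_on D1 (\<Sum>j\<le>t. w_expansion (\<Phi> j) * F ^ (t - j)) 0"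
  shows "(\<forall>(z, w)\<in>D. summable (\<lambda>n. fps_nth F n z * w ^ n)) \<and>
    holo_N1 (\<lambda>(z, w). eval_fps (fps_at F z) w) D \<and>
    fps_eq_on D1 (w_expansion (\<lambda>(z, w). eval_fps (fps_at F z) w)) F"
proof -
  have D2: "D2 = eball 0 R" by (simp add: D2_def eball_def)
  from C1 obtain S where S: "S \<subseteq> D1" "D1 \<subseteq> closure S"
    and sum: "\<forall>\<alpha>\<in>S. (\<forall>w\<in>D2. summable (\<lambda>n. fps_nth F n \<alpha> * w ^ n)) \<and>
      (\<lambda>w. eval_fps (fps_at F \<alpha>) w) holomorphic_on D2"
    by (elim exE conjE)
  from C2 obtain t \<Phi> where \<Phi>: "t \<ge> 1" "\<forall>j\<le>t. holo_N1 (\<Phi> j) D" "\<exists>p\<in>D. \<Phi> 0 p \<noteq> 0"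
    "fps_eq_on D1 (\<Sum>j\<le>t. w_expansion (\<Phi> j) * F ^ (t - j)) 0"
    by (elim exE conjE)
  interpret algebraic_series D1 R F S t \<Phi>
    using domain_D1 R_pos F_coeffs S sum \<Phi> unfolding D_def D2 by unfold_locales simp_all
  show ?thesis
    using summable_D eval_holomorphic w_expansion_eval unfolding D_def D2 by blast
qed

end
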